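(* Let $S\subset\mathbb{N}^3$ be the set of all triples $(r_3,r_6,n)\in\mathbb{N}^3$ such that $(x_3,x_6,y)=(r_3,r_6,n)$ satisfies the system of linear Diophantine inequalities \[ y\ge 4x_3+5x_6+3,\qquad y\le 3x_3+6x_6-1 , \] and let $T$ be the set of the possible values of $n$, i.e. the set of integers $n$ for which the system has a solution $(x_3,x_6,y)=(r_3,r_6,n)\in\mathbb{N}^3$. Then the characteristic series of $S$ is \[ \chi_S(x_3,x_6,y)=\frac{x_6^4y^{23}}{(1-x_6y^5)(1-x_6y^6)(1-x_3x_6y^9)}. \] Hence all solutions $(r_3,r_6,n)\in S$ of the system are \[ (r_3,r_6,n)=(0,4,23)+c_1(0,1,5)+c_2(0,1,6)+c_3(1,1,9),\quad c_1,c_2,c_3\in\mathbb{N}. \] Replacing $x_3$ and $x_6$ with $1$ in $\chi_S(x_3,x_6,y)$ one obtains the characteristic series of the set $T$ of the possible values of $n$: \[ \chi_T(y)=\chi_S(1,1,y)=\frac{y^{23}}{(1-y^5)(1-y^6)(1-y^9)}. \]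
   Context: $\mathbb{N}$ denotes the set of nonnegative integers (including $0$). For a set $P\subset\mathbb{N}^k$, its characteristic series is the formal power series $\chi_P(t_1,\ldots,t_k)=\sum_{p=(p_1,\ldots,p_k)\in P}t_1^{p_1}\cdots t_k^{p_k}$; rational functions are identified with their expansions as formal power series. The system comes from a transport problem: $y$ is the number of cars to be transported, and $x_3$, $x_6$ are the numbers of small trucks (capacity three cars, cost 1200 euros each) and large trucks (capacity six cars, cost 1500 euros each); the company receives 300 euros per car, transports one additional car free of charge, and requires a profit of at least 900 euros. The original problem asks for the set $T$.
   Formalization: The equality of χ_T(y) with χ_S(1,1,y) fails, since (0,7,38) and (1,6,38) both lie in S; instead χ_S(1,1,y) is shown to count the solutions for each n, and χ_T arises from it by replacing nonzero coefficients with 1. *)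

theory Defs
  imports
    "HOL-Computational_Algebra.Formal_Power_Series"
    "HOL-Library.Product_Plus"
begin

unbundle fps_syntax

(* Power series in (x3, x6, y) with rational coefficients are iterated univariate ones: the
   outermost variable is x3, the innermost one is y, and F $ i $ j $ n is the coefficient of
   x3^i x6^j y^n in F. *)

type_synonym fps3 = "rat fps fps fps"

definition var_x3 :: fps3 where
  "var_x3 = fps_X"

definition var_x6 :: fps3 where
  "var_x6 = fps_const fps_X"

definition var_y :: fps3 where
  "var_y = fps_const (fps_const fps_X)"

definition char_series :: "nat set \<Rightarrow> rat fps" where
  "char_series P = Abs_fps (\<lambda>n. of_bool (n \<in> P))"

definition char_series3 :: "(nat \<times> nat \<times> nat) set \<Rightarrow> fps3" where
  "char_series3 P =
     Abs_fps (\<lambda>i. Abs_fps (\<lambda>j. Abs_fps (\<lambda>n. of_bool ((i, j, n) \<in> P))))"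

(* The library division of iterated power series is the expansion of a rational function as soon
   as the constant term of the denominator is nonzero: the quotient is the unique solution Q of
   Q * D = F (the ring is an integral domain). *)
lemma fps_divide_mult_cancel3:
  fixes F D :: fps3
  assumes "D $ 0 $ 0 $ 0 \<noteq> 0"
  shows "F / D * D = F"
proof -
  have 1: "inverse (D $ 0 $ 0) * (D $ 0 $ 0) = 1"
    using assms by (rule inverse_mult_eq_1)
  have 2: "fps_left_inverse (D $ 0) (inverse (D $ 0 $ 0)) * (D $ 0) = 1"
    using 1 by (rule fps_left_inverse)
  have 3: "inverse (D $ 0) * (D $ 0) = 1"
    using 1 fps_right_inverse[of "D $ 0" "inverse (D $ 0 $ 0)"]
    by (simp add: fps_inverse_def mult.commute)
  have 4: "inverse D * D = 1"
    using 3 fps_right_inverse[of D "inverse (D $ 0)"]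
    by (simp add: fps_inverse_def mult.commute)
  have "D $ 0 \<noteq> 0"
    using assms by auto
  then have "F / D = F * inverse D"
    by (rule fps_divide_unit)
  with 4 show ?thesis
    by (simp add: mult.assoc)
qed

(* Replacing x3 and x6 with 1.  This is meaningful only if, for every n, finitely many monomials
   x3^i x6^j y^n occur in F. *)
definition ones_admissible :: "fps3 \<Rightarrow> bool" where
  "ones_admissible F \<longleftrightarrow> (\<forall>n. finite {(i, j). F $ i $ j $ n \<noteq> 0})"

definition subst_ones :: "fps3 \<Rightarrow> rat fps" where
  "subst_ones F = Abs_fps (\<lambda>n. \<Sum>(i, j) | F $ i $ j $ n \<noteq> 0. F $ i $ j $ n)"

definition sol_set :: "(nat \<times> nat \<times> nat) set" where
  "sol_set = {(r3, r6, n).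
     int n \<ge> 4 * int r3 + 5 * int r6 + 3 \<and> int n \<le> 3 * int r3 + 6 * int r6 - 1}"

definition possible_values :: "nat set" where
  "possible_values = {n. \<exists>r3 r6. (r3, r6, n) \<in> sol_set}"

(* As an identity between series with coefficients 0 and 1, "chi_T(y) = chi_S(1,1,y)" fails: both
   (0,7,38) and (1,6,38) are solutions, so y^38 has coefficient 2 on the right.  The identity holds
   when each value n in T is counted once for every solution (r3, r6, n). *)
definition weighted_value_series :: "rat fps" where
  "weighted_value_series = Abs_fps (\<lambda>n. of_nat (card {(r3, r6). (r3, r6, n) \<in> sol_set}))"

definition scale3 :: "nat \<Rightarrow> nat \<times> nat \<times> nat \<Rightarrow> nat \<times> nat \<times> nat" (infixr "\<odot>" 75) where
  "c \<odot> v = (case v of (i, j, n) \<Rightarrow> (c * i, c * j, c * n))"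

end

(* With c1 = 3 x3 + 6 x6 - 1 - y, c2 = y - 4 x3 - 5 x6 - 3 and c3 = x3, the system says exactly that
   c1 and c2 are nonnegative, and (c1, c2, c3) determines the solution: S is a translate of the free
   monoid on the three generators.  If P is stable under translation by v, multiplying the series
   of P by 1 - t^v leaves the series of P - (v + P); doing this for the three generators reduces S
   to the single point (0, 4, 23), both in three variables and after setting x3 = x6 = 1. *)

theory Submission
  imports Defs
begin

section \<open>Characteristic series and translation by a monomial\<close>

definition monomial3 :: "nat \<times> nat \<times> nat \<Rightarrow> fps3" where
  "monomial3 v = (case v of (a, b, c) \<Rightarrow> var_x3 ^ a * var_x6 ^ b * var_y ^ c)"

lemma mult_monomial3_nth:
  "(F * monomial3 (a, b, c)) $ i $ j $ n =
     (if a \<le> i \<and> b \<le> j \<and> c \<le> n then F $ (i - a) $ (j - b) $ (n - c) else 0)"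
proof -
  \<comment> \<open>In this nesting, each of the three layers of coefficients meets either a power
    of \<open>fps_X\<close> or a constant factor.\<close>
  have "F * monomial3 (a, b, c) =
          fps_X ^ a * (fps_const (fps_X ^ b) * (fps_const (fps_const (fps_X ^ c)) * F))"
    by (simp add: monomial3_def var_x3_def var_x6_def var_y_def fps_const_power ac_simps)
  then show ?thesis
    by (simp only: fps_X_power_mult_nth fps_mult_left_const_nth) (simp add: fps_X_power_mult_nth)
qed

lemma char_series3_nth: "char_series3 P $ i $ j $ n = of_bool ((i, j, n) \<in> P)"
  by (simp add: char_series3_def)

lemma fps3_eqI:
  fixes F G :: fps3
  assumes "\<And>i j n. F $ i $ j $ n = G $ i $ j $ n"
  shows "F = G"
  using assms by (intro fps_ext)

lemma mem_translate_iff: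
  fixes a b c i j n :: nat
  shows "(i, j, n) \<in> (+) (a, b, c) ` P \<longleftrightarrow>
    a \<le> i \<and> b \<le> j \<and> c \<le> n \<and> (i - a, j - b, n - c) \<in> P"
  by (force simp: image_iff intro: bexI[of _ "(i - a, j - b, n - c)"])

text \<open>Multiplication by the monomial turns the indicator of \<open>P\<close> into that of its
  translate. Stability puts the translate inside \<open>P\<close>, so the difference is again an
  indicator.\<close>

lemma char_series3_mult_one_minus_monomial3:
  assumes "(+) v ` P \<subseteq> P"
  shows "char_series3 P * (1 - monomial3 v) = char_series3 (P - (+) v ` P)"
proof (cases v)
  case (fields a b c)
  have "of_bool ((i, j, n) \<in> P) -
      (if a \<le> i \<and> b \<le> j \<and> c \<le> n then of_bool ((i - a, j - b, n - c) \<in> P) else 0) =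
    (of_bool ((i, j, n) \<in> P - (+) (a, b, c) ` P) :: rat)" for i j n
  proof -
    have "(i, j, n) \<in> (+) (a, b, c) ` P \<Longrightarrow> (i, j, n) \<in> P"
      using assms unfolding fields by blast
    then show ?thesis
      unfolding Diff_iff mem_translate_iff by (auto simp only: of_bool_def split: if_splits)
  qed
  then show ?thesis
    unfolding fields
    by (intro fps3_eqI)
       (simp only: right_diff_distrib mult_1_right fps_sub_nth mult_monomial3_nth char_series3_nth)
qed

lemma char_series3_singleton: "char_series3 {v} = monomial3 v"
proof (cases v)
  case (fields a b c)
  have one: "(1 :: fps3) $ i $ j $ n = of_bool (i = 0 \<and> j = 0 \<and> n = 0)" for i j n
    by simp
  \<comment> \<open>The factor 1 is inserted so that \<open>mult_monomial3_nth\<close>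
    applies.\<close>
  have "(1 * monomial3 v) $ i $ j $ n = of_bool ((i, j, n) = v)" for i j n
    unfolding fields mult_monomial3_nth one by auto
  then show ?thesis
    by (intro fps3_eqI) (simp add: char_series3_nth)
qed

section \<open>Setting x3 = x6 = 1\<close>

lemma ones_admissible_char_series3:
  "ones_admissible (char_series3 P) \<longleftrightarrow> (\<forall>n. finite {(i, j). (i, j, n) \<in> P})"
  by (simp add: ones_admissible_def char_series3_nth)

text \<open>For an infinite fibre both sides are 0, by the conventions for \<open>sum\<close> and
  \<open>card\<close>.\<close>

lemma subst_ones_char_series3_nth:
  "subst_ones (char_series3 P) $ n = of_nat (card {(i, j). (i, j, n) \<in> P})"
proof -
  have "subst_ones (char_series3 P) $ n = (\<Sum>(i, j) | (i, j, n) \<in> P. of_bool ((i, j, n) \<in> P))"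
    by (simp add: subst_ones_def char_series3_nth)
  also have "\<dots> = (\<Sum>p | case p of (i, j) \<Rightarrow> (i, j, n) \<in> P. 1)"
    by (intro sum.cong) auto
  finally show ?thesis
    by simp
qed

text \<open>The one-variable counterpart of \<open>char_series3_mult_one_minus_monomial3\<close>. It
  is proved by counting fibres over \<open>n\<close>, which avoids a product rule for
  \<open>subst_ones\<close>; admissibility makes the cardinalities finite, so that they
  subtract.\<close>

lemma subst_ones_char_series3_mult:
  assumes translate: "(+) (a, b, c) ` P \<subseteq> P" and adm: "ones_admissible (char_series3 P)"
  shows "subst_ones (char_series3 P) * (1 - fps_X ^ c) =
    subst_ones (char_series3 (P - (+) (a, b, c) ` P))"
proof (rule fps_ext)
  fix n
  define fibre where "fibre Q = {(i, j). (i, j, n) \<in> Q}" for Q :: "(nat \<times> nat \<times> nat) set"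
  have fin: "finite (fibre P)"
    using adm by (simp add: ones_admissible_char_series3 fibre_def)
  have sub: "fibre ((+) (a, b, c) ` P) \<subseteq> fibre P"
    using translate unfolding fibre_def by blast
  have "fibre (P - (+) (a, b, c) ` P) = fibre P - fibre ((+) (a, b, c) ` P)"
    by (auto simp: fibre_def)
  then have diff: "card (fibre (P - (+) (a, b, c) ` P)) + card (fibre ((+) (a, b, c) ` P)) =
      card (fibre P)"
    using sub fin by (simp add: card_Diff_subset card_mono finite_subset)
  have shift: "card (fibre ((+) (a, b, c) ` P)) =
      (if c \<le> n then card {(i, j). (i, j, n - c) \<in> P} else 0)"
  proof (cases "c \<le> n")
    case True
    \<comment> \<open>Translation by \<open>(a, b)\<close> is injective, so the shifted fibre has as
      many points as the fibre over \<open>n - c\<close>.\<close>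
    have "fibre ((+) (a, b, c) ` P) = (+) (a, b) ` {(i, j). (i, j, n - c) \<in> P}"
      using True unfolding fibre_def mem_translate_iff
      by (force simp: image_iff)
    then show ?thesis
      using True by (simp add: card_image)
  next
    case False
    then show ?thesis
      by (simp add: fibre_def mem_translate_iff)
  qed
  have "of_nat (card (fibre (P - (+) (a, b, c) ` P))) =
      (of_nat (card (fibre P)) - of_nat (card (fibre ((+) (a, b, c) ` P))) :: rat)"
    by (simp flip: diff)
  then show "(subst_ones (char_series3 P) * (1 - fps_X ^ c)) $ n =
      subst_ones (char_series3 (P - (+) (a, b, c) ` P)) $ n"
    unfolding shift
    by (simp add: right_diff_distrib fps_X_power_mult_right_nth subst_ones_char_series3_nth
        fibre_def)
qed

lemma subst_ones_monomial3: "subst_ones (monomial3 (a, b, c)) = fps_X ^ c"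
proof (rule fps_ext)
  fix n
  have "{(i, j). (i, j, n) \<in> {(a, b, c)}} = (if n = c then {(a, b)} else {})"
    by auto
  then show "subst_ones (monomial3 (a, b, c)) $ n = (fps_X ^ c :: rat fps) $ n"
    unfolding char_series3_singleton[symmetric] subst_ones_char_series3_nth
    by (simp add: fps_X_power_nth)
qed

lemma ones_admissible_char_series3_mono:
  assumes "ones_admissible (char_series3 Q)" and "P \<subseteq> Q"
  shows "ones_admissible (char_series3 P)"
proof -
  have "{(i, j). (i, j, n) \<in> P} \<subseteq> {(i, j). (i, j, n) \<in> Q}" for n
    using assms(2) by blast
  then show ?thesis
    using assms(1) unfolding ones_admissible_char_series3 by (metis finite_subset)
qed

text \<open>Reduces a quotient formula to a product identity, by cancelling \<open>D\<close> in an
  integral domain.\<close>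

lemma fps3_divide_eqI:
  fixes Q F D :: fps3
  assumes "Q * D = F" and "D $ 0 $ 0 $ 0 \<noteq> 0"
  shows "F / D = Q"
proof -
  have "F / D * D = Q * D"
    using fps_divide_mult_cancel3[OF assms(2)] assms(1) by simp
  moreover have "D \<noteq> 0"
    using assms(2) by auto
  ultimately show ?thesis
    by simp
qed

section \<open>The solution set and its reduction to one point\<close>

lemma sol_set_iff:
  "(i, j, n) \<in> sol_set \<longleftrightarrow> 4 * i + 5 * j + 3 \<le> n \<and> n + 1 \<le> 3 * i + 6 * j"
  by (auto simp: sol_set_def)

lemma sol_set_eq:
  "sol_set = {(0, 4, 23) + c1 \<odot> (0, 1, 5) + c2 \<odot> (0, 1, 6) + c3 \<odot> (1, 1, 9) | c1 c2 c3. True}"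
proof -
  have "\<exists>c1 c2 c3. i = c3 \<and> j = 4 + c1 + c2 + c3 \<and> n = 23 + 5 * c1 + 6 * c2 + 9 * c3"
    if "(i, j, n) \<in> sol_set" for i j n
    using that
    \<comment> \<open>The first two witnesses are the slacks of the two inequalities; membership in
      \<open>sol_set\<close> makes the truncated subtractions exact.\<close>
    by (intro exI[of _ "3 * i + 6 * j - 1 - n"] exI[of _ "n - (4 * i + 5 * j + 3)"] exI[of _ i])
       (auto simp: sol_set_iff)
  then show ?thesis
    by (fastforce simp: scale3_def sol_set_iff)
qed

lemma ones_admissible_sol_set: "ones_admissible (char_series3 sol_set)"
  unfolding ones_admissible_char_series3
proof
  fix n
  show "finite {(i, j). (i, j, n) \<in> sol_set}"
    by (rule finite_subset[of _ "{..n} \<times> {..n}"]) (auto simp: sol_set_iff)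
qed

text \<open>The solutions with \<open>c3 = 0\<close>, left after the first reduction;
  \<open>sol_set_ray\<close> below also has \<open>c2 = 0\<close>, that is, equality in the lower
  bound.\<close>

definition sol_set_no_x3 :: "(nat \<times> nat \<times> nat) set" where
  "sol_set_no_x3 = {(i, j, n). i = 0 \<and> 5 * j + 3 \<le> n \<and> n + 1 \<le> 6 * j}"

definition sol_set_ray :: "(nat \<times> nat \<times> nat) set" where
  "sol_set_ray = {(i, j, n). i = 0 \<and> 4 \<le> j \<and> n = 5 * j + 3}"

lemma sol_set_translate: "(+) (1, 1, 9) ` sol_set \<subseteq> sol_set"
  by (auto simp: sol_set_iff)

text \<open>Since 4 + 5 = 3 + 6 = 9, the shift preserves both slacks, so a solution lies in the
  translate exactly when its first coordinate is positive.\<close>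

lemma sol_set_diff: "sol_set - (+) (1, 1, 9) ` sol_set = sol_set_no_x3"
  by (auto simp: sol_set_iff sol_set_no_x3_def mem_translate_iff)

lemma sol_set_no_x3_translate: "(+) (0, 1, 6) ` sol_set_no_x3 \<subseteq> sol_set_no_x3"
  by (auto simp: sol_set_no_x3_def)

text \<open>The shift preserves the upper slack and raises the lower one by 1, so the points with
  lower slack 0 remain.\<close>

lemma sol_set_no_x3_diff: "sol_set_no_x3 - (+) (0, 1, 6) ` sol_set_no_x3 = sol_set_ray"
  by (auto simp: sol_set_no_x3_def sol_set_ray_def mem_translate_iff)

lemma sol_set_ray_translate: "(+) (0, 1, 5) ` sol_set_ray \<subseteq> sol_set_ray"
  by (auto simp: sol_set_ray_def)

lemma sol_set_ray_diff: "sol_set_ray - (+) (0, 1, 5) ` sol_set_ray = {(0, 4, 23)}"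
  by (auto simp: sol_set_ray_def mem_translate_iff)

lemma char_series3_sol_set_mult:
  "char_series3 sol_set *
     ((1 - monomial3 (0, 1, 5)) * (1 - monomial3 (0, 1, 6)) * (1 - monomial3 (1, 1, 9))) =
   monomial3 (0, 4, 23)"
proof -
  have "char_series3 sol_set *
      ((1 - monomial3 (0, 1, 5)) * (1 - monomial3 (0, 1, 6)) * (1 - monomial3 (1, 1, 9))) =
    char_series3 sol_set * (1 - monomial3 (1, 1, 9)) * (1 - monomial3 (0, 1, 6)) *
      (1 - monomial3 (0, 1, 5))"
    by (simp only: ac_simps)
  also have "\<dots> = monomial3 (0, 4, 23)"
    by (simp only: char_series3_mult_one_minus_monomial3 sol_set_translate sol_set_diff
        sol_set_no_x3_translate sol_set_no_x3_diff sol_set_ray_translate sol_set_ray_diff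
        char_series3_singleton)
  finally show ?thesis .
qed

lemma subst_ones_sol_set_mult:
  "subst_ones (char_series3 sol_set) * ((1 - fps_X ^ 5) * (1 - fps_X ^ 6) * (1 - fps_X ^ 9)) =
   fps_X ^ 23"
proof -
  \<comment> \<open>Both intermediate sets inherit admissibility as subsets of
    \<open>sol_set\<close>.\<close>
  have adm: "ones_admissible (char_series3 sol_set_no_x3)"
    "ones_admissible (char_series3 sol_set_ray)"
    using ones_admissible_char_series3_mono[OF ones_admissible_sol_set]
    by (auto simp: sol_set_no_x3_def sol_set_ray_def sol_set_iff subset_iff)
  have "subst_ones (char_series3 sol_set) * ((1 - fps_X ^ 5) * (1 - fps_X ^ 6) * (1 - fps_X ^ 9)) =
    subst_ones (char_series3 sol_set) * (1 - fps_X ^ 9) * (1 - fps_X ^ 6) * (1 - fps_X ^ 5)"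
    by (simp only: ac_simps)
  also have "\<dots> = fps_X ^ 23"
    by (simp only: subst_ones_char_series3_mult[OF sol_set_translate ones_admissible_sol_set]
        subst_ones_char_series3_mult[OF sol_set_no_x3_translate adm(1)]
        subst_ones_char_series3_mult[OF sol_set_ray_translate adm(2)]
        sol_set_diff sol_set_no_x3_diff sol_set_ray_diff char_series3_singleton
        subst_ones_monomial3)
  finally show ?thesis .
qed

theorem mainTheorem1:
  shows "char_series3 sol_set =
           var_x6 ^ 4 * var_y ^ 23 /
           ((1 - var_x6 * var_y ^ 5) * (1 - var_x6 * var_y ^ 6) * (1 - var_x3 * var_x6 * var_y ^ 9))
       \<and> sol_set = {(0, 4, 23) + c1 \<odot> (0, 1, 5) + c2 \<odot> (0, 1, 6) + c3 \<odot> (1, 1, 9) | c1 c2 c3. True}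
       \<and> ones_admissible (char_series3 sol_set)
       \<and> weighted_value_series = subst_ones (char_series3 sol_set)
       \<and> subst_ones (char_series3 sol_set) =
           fps_X ^ 23 / ((1 - fps_X ^ 5) * (1 - fps_X ^ 6) * (1 - fps_X ^ 9))
       \<and> char_series possible_values =
           Abs_fps (\<lambda>n. of_bool (subst_ones (char_series3 sol_set) $ n \<noteq> 0))"
proof (intro conjI)
  show "char_series3 sol_set =
      var_x6 ^ 4 * var_y ^ 23 /
      ((1 - var_x6 * var_y ^ 5) * (1 - var_x6 * var_y ^ 6) * (1 - var_x3 * var_x6 * var_y ^ 9))"
  proof (rule fps3_divide_eqI[symmetric])
    show "char_series3 sol_set *
        ((1 - var_x6 * var_y ^ 5) * (1 - var_x6 * var_y ^ 6) * (1 - var_x3 * var_x6 * var_y ^ 9)) =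
        var_x6 ^ 4 * var_y ^ 23"
      using char_series3_sol_set_mult by (simp add: monomial3_def)
    show "((1 - var_x6 * var_y ^ 5) * (1 - var_x6 * var_y ^ 6) * (1 - var_x3 * var_x6 * var_y ^ 9))
        $ 0 $ 0 $ 0 \<noteq> 0"
      by (simp add: var_x3_def var_x6_def var_y_def fps_const_power)
  qed
  show "subst_ones (char_series3 sol_set) =
      fps_X ^ 23 / ((1 - fps_X ^ 5) * (1 - fps_X ^ 6) * (1 - fps_X ^ 9))"
  proof -
    have "((1 - fps_X ^ 5) * (1 - fps_X ^ 6) * (1 - fps_X ^ 9) :: rat fps) $ 0 \<noteq> 0"
      by simp
    then have "(1 - fps_X ^ 5) * (1 - fps_X ^ 6) * (1 - fps_X ^ 9) \<noteq> (0 :: rat fps)"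
      by (metis fps_zero_nth)
    \<comment> \<open>The numerator is rewritten as series times denominator, and the nonzero
      denominator cancels.\<close>
    then show ?thesis
      unfolding subst_ones_sol_set_mult[symmetric] by (rule nonzero_mult_div_cancel_right[symmetric])
  qed
  show "char_series possible_values =
      Abs_fps (\<lambda>n. of_bool (subst_ones (char_series3 sol_set) $ n \<noteq> 0))"
  proof (rule fps_ext)
    fix n
    \<comment> \<open>Finiteness is essential here: an infinite fibre would have \<open>card\<close>
      0 although \<open>n\<close> is a possible value.\<close>
    have "finite {(i, j). (i, j, n) \<in> sol_set}"
      using ones_admissible_sol_set by (simp add: ones_admissible_char_series3)
    then show "char_series possible_values $ n =
        Abs_fps (\<lambda>n. of_bool (subst_ones (char_series3 sol_set) $ n \<noteq> 0)) $ n"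
      by (auto simp: char_series_def possible_values_def subst_ones_char_series3_nth card_gt_0_iff)
  qed
  show "weighted_value_series = subst_ones (char_series3 sol_set)"
    by (rule fps_ext) (simp add: weighted_value_series_def subst_ones_char_series3_nth)
qed (fact sol_set_eq ones_admissible_sol_set)+

end
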